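(* Call a measurable function $W:\mathbb{R}^2\to\mathbb{R}$ admissible if $W(q,p)\ge 0$ and $\pi W(q,p)\le 1$ for all $(q,p)$, and $\int_{\mathbb{R}^2} W(q,p)\,dq\,dp=1$. (1) For every $\mu\in(0,2]$ there exists an admissible $W$ with $2\pi\int_{\mathbb{R}^2}W(q,p)^2\,dq\,dp=\mu$ and $$S[W]=\ln\left(\frac{2\pi}{\mu}\right).$$ (2) Consequently, for every $\mu\in(0,2]$ with $\mu>2/e$, there exists an admissible $W$ with $2\pi\int_{\mathbb{R}^2}W(q,p)^2\,dq\,dp=\mu$ and $S[W]=\ln(2\pi/\mu)<1+\ln\pi$. (3) In particular, for no real number $\mu_\star>2/e$ does the following implication hold for all admissible $W$: if $2\pi\int_{\mathbb{R}^2}W(q,p)^2\,dq\,dp\le\mu_\star$, then $S[W]\ge 1+\ln\pi$.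
   Context: $S[W]:=-\int_{\mathbb{R}^2} W(q,p)\ln W(q,p)\,dq\,dp$ is the Shannon differential entropy of $W$ (the "Wigner entropy"), with the convention $0\ln 0=0$; for admissible $W$ it is well defined in $[0,+\infty]$ since $0\le W\le 1/\pi<1$. The quantity $2\pi\int W^2$ is called the purity of $W$. Admissible functions are not required to be Wigner functions of quantum states. *)

theory Defs
  imports "HOL-Analysis.Analysis"
begin

definition admissible :: "(real \<times> real \<Rightarrow> real) \<Rightarrow> bool" where
  "admissible W \<longleftrightarrow>
     W \<in> borel_measurable lborel \<and>
     (\<forall>q p. 0 \<le> W (q, p) \<and> pi * W (q, p) \<le> 1) \<and>
     has_bochner_integral lborel W 1"

text \<open>
  For admissible \<open>W\<close> one has \<open>0 \<le> W\<^sup>2 \<le> W / pi\<close>, so the integrand below is integrable.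
\<close>

definition purity :: "(real \<times> real \<Rightarrow> real) \<Rightarrow> real" where
  "purity W = 2 * pi * (\<integral>z. (W z)\<^sup>2 \<partial>lborel)"

text \<open>
  The entropy of an admissible function may be infinite, so the integral of \<open>- W ln W\<close> is taken
  in the extended reals, as the integral of the positive part minus that of the negative part
  (\<open>ennreal\<close> maps negative reals to \<open>0\<close>). For admissible \<open>W\<close> the negative part vanishes, because
  \<open>0 \<le> W \<le> 1 / pi < 1\<close>. At zeros of \<open>W\<close> the integrand is \<open>0\<close>, as required.
\<close>

definition wigner_entropy :: "(real \<times> real \<Rightarrow> real) \<Rightarrow> ereal" where
  "wigner_entropy W =
     enn2ereal (\<integral>\<^sup>+z. ennreal (- (W z * ln (W z))) \<partial>lborel)
     - enn2ereal (\<integral>\<^sup>+z. ennreal (W z * ln (W z)) \<partial>lborel)"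

end

theory Submission
  imports Defs
begin

text \<open>
  A uniform density of height \<open>c\<close> on a set of area \<open>1 / c\<close> has purity \<open>2 \<pi> c\<close> and entropy
  \<open>- ln c\<close>; the bound \<open>\<pi> W \<le> 1\<close> says exactly that the purity is at most \<open>2\<close>.
\<close>

definition uniform_density :: "real \<Rightarrow> real \<times> real \<Rightarrow> real" where
  "uniform_density c z = c * indicator (cbox (0, 0) (1 / c, 1)) z"

lemma measure_box:
  assumes "0 \<le> a"
  shows "measure lborel (cbox (0, 0) (a, 1) :: (real \<times> real) set) = a"
  using assms by (simp add: content_Pair)

lemma emeasure_box:
  assumes "0 \<le> a"
  shows "emeasure lborel (cbox (0, 0) (a, 1) :: (real \<times> real) set) = ennreal a"
  using measure_box[OF assms] emeasure_eq_ennreal_measure[of lborel "cbox (0, 0) (a, 1) :: (real \<times> real) set"]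
    emeasure_lborel_cbox_finite[of "(0, 0) :: real \<times> real" "(a, 1)"]
  by simp

text \<open>The height \<open>k\<close> is kept independent of the width \<open>a\<close> so that
  one computation serves twice at \<open>a = 1 / c\<close>: \<open>k = c\<close> gives total mass 1,
  and \<open>k = c\<^sup>2\<close> gives the integral of the squared density.\<close>

lemma has_bochner_integral_box:
  assumes "0 \<le> a"
  shows "has_bochner_integral lborel
    (\<lambda>z :: real \<times> real. k * indicator (cbox (0, 0) (a, 1)) z) (k * a)"
proof -
  have "has_bochner_integral lborel
      (\<lambda>z :: real \<times> real. indicator (cbox (0, 0) (a, 1)) z :: real) a"
    using has_bochner_integral_real_indicator[of "cbox (0, 0) (a, 1) :: (real \<times> real) set" lborel]
      measure_box[OF assms] emeasure_box[OF assms] by simp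
  then show ?thesis by (intro has_bochner_integral_mult_right) simp
qed

lemma admissible_uniform_density:
  assumes "0 < c" "pi * c \<le> 1"
  shows "admissible (uniform_density c)"
proof -
  have "has_bochner_integral lborel (uniform_density c) 1"
    using has_bochner_integral_box[of "1 / c" c] assms(1)
    by (simp add: uniform_density_def[abs_def])
  moreover have "0 \<le> uniform_density c z \<and> pi * uniform_density c z \<le> 1" for z
    using assms by (simp add: uniform_density_def indicator_def)
  ultimately show ?thesis
    unfolding admissible_def by (blast intro: borel_measurable_has_bochner_integral)
qed

lemma purity_uniform_density:
  assumes "0 < c"
  shows "purity (uniform_density c) = 2 * pi * c"
proof -
  \<comment> \<open>An indicator is idempotent, so squaring only changes the height on the
    box.\<close>
  have "(\<lambda>z. (uniform_density c z)\<^sup>2) =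
      (\<lambda>z. c\<^sup>2 * indicator (cbox (0, 0) (1 / c, 1)) z)"
    by (auto simp: uniform_density_def indicator_def)
  then have "(\<integral>z. (uniform_density c z)\<^sup>2 \<partial>lborel) = c\<^sup>2 * (1 / c)"
    using has_bochner_integral_integral_eq[OF has_bochner_integral_box[of "1 / c" "c\<^sup>2"]] assms
    by simp
  then show ?thesis
    using assms by (simp add: purity_def power2_eq_square)
qed

text \<open>The integrand is the constant \<open>- (c * ln c)\<close> on a box of area
  \<open>1 / c\<close>. The bound \<open>c \<le> 1\<close> makes this constant nonnegative, so
  \<open>ennreal\<close> does not truncate it and the subtracted integral is zero.\<close>

lemma wigner_entropy_uniform_density:
  assumes "0 < c" "c \<le> 1"
  shows "wigner_entropy (uniform_density c) = ereal (- ln c)"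
proof -
  have le0: "c * ln c \<le> 0"
    using assms by (simp add: mult_nonneg_nonpos)
  \<comment> \<open>Off the box the factor 0 in front of the logarithm makes the product 0, so the
    identity holds at every point.\<close>
  have "(\<lambda>z. ennreal (- (uniform_density c z * ln (uniform_density c z)))) =
      (\<lambda>z. ennreal (- (c * ln c)) * indicator (cbox (0, 0) (1 / c, 1)) z)"
    by (auto simp: uniform_density_def indicator_def)
  then have "(\<integral>\<^sup>+z. ennreal (- (uniform_density c z * ln (uniform_density c z))) \<partial>lborel) =
      ennreal (- (c * ln c)) * ennreal (1 / c)"
    using assms by (simp add: nn_integral_cmult_indicator emeasure_box)
  also have "\<dots> = ennreal (- (c * ln c) * (1 / c))"
    using assms le0 by (intro ennreal_mult[symmetric]) auto
  also have "- (c * ln c) * (1 / c) = - ln c"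
    using assms by simp
  finally have pos: "(\<integral>\<^sup>+z. ennreal (- (uniform_density c z * ln (uniform_density c z))) \<partial>lborel) =
      ennreal (- ln c)" .
  have "(\<lambda>z. ennreal (uniform_density c z * ln (uniform_density c z))) = (\<lambda>_. 0)"
    using le0 by (auto simp: uniform_density_def indicator_def ennreal_neg)
  then show ?thesis
    using assms by (simp add: wigner_entropy_def pos zero_ennreal.rep_eq)
qed

lemma exists_admissible_with_purity:
  assumes "0 < \<mu>" "\<mu> \<le> 2"
  shows "\<exists>W. admissible W \<and> purity W = \<mu> \<and> wigner_entropy W = ereal (ln (2 * pi / \<mu>))"
proof (intro exI conjI)
  \<comment> \<open>This solves \<open>2 * pi * c = \<mu>\<close>; the assumption
    \<open>\<mu> \<le> 2\<close> then reads \<open>pi * c \<le> 1\<close>.\<close>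
  define c where "c = \<mu> / (2 * pi)"
  have c: "0 < c" "pi * c \<le> 1"
    using assms by (simp_all add: c_def)
  \<comment> \<open>Admissibility bounds \<open>pi * c\<close>, while the entropy formula asks for
    \<open>c \<le> 1\<close>; \<open>pi > 1\<close> bridges the two.\<close>
  have "1 * c \<le> pi * c"
    using c(1) pi_gt3 by (intro mult_right_mono) auto
  then have "c \<le> 1"
    using c(2) by simp
  show "admissible (uniform_density c)"
    using c by (rule admissible_uniform_density)
  show "purity (uniform_density c) = \<mu>"
    by (simp add: purity_uniform_density[OF c(1)]) (simp add: c_def)
  have "- ln c = ln (2 * pi / \<mu>)"
    using assms by (simp add: c_def ln_div)
  then show "wigner_entropy (uniform_density c) = ereal (ln (2 * pi / \<mu>))"
    using wigner_entropy_uniform_density[OF c(1) \<open>c \<le> 1\<close>] by simp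
qed

text \<open>Since \<open>1 + ln pi = ln (exp 1 * pi)\<close>, the value \<open>2 / exp 1\<close> is
  exactly the purity at which both sides agree, and the left side strictly decreases in
  \<open>\<mu>\<close>.\<close>

lemma ln_two_pi_div_less:
  assumes "2 / exp 1 < \<mu>"
  shows "ln (2 * pi / \<mu>) < 1 + ln pi"
proof -
  have "0 < 2 / exp (1 :: real)"
    by simp
  then have \<mu>: "0 < \<mu>"
    using assms by linarith
  have "2 * pi / \<mu> < exp 1 * pi"
    using assms \<mu> by (simp add: field_simps)
  then have "ln (2 * pi / \<mu>) < ln (exp 1 * pi)"
    using \<mu> by (subst ln_less_cancel_iff) auto
  then show ?thesis
    by (simp add: ln_mult)
qed

theorem proposition1:
  shows "(\<forall>\<mu>::real. 0 < \<mu> \<and> \<mu> \<le> 2 \<longrightarrow>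
            (\<exists>W. admissible W \<and> purity W = \<mu> \<and>
                 wigner_entropy W = ereal (ln (2 * pi / \<mu>))))
       \<and> (\<forall>\<mu>::real. 0 < \<mu> \<and> \<mu> \<le> 2 \<and> \<mu> > 2 / exp 1 \<longrightarrow>
            (\<exists>W. admissible W \<and> purity W = \<mu> \<and>
                 wigner_entropy W = ereal (ln (2 * pi / \<mu>)) \<and>
                 ln (2 * pi / \<mu>) < 1 + ln pi))
       \<and> \<not> (\<exists>\<mu>\<^sub>s::real. \<mu>\<^sub>s > 2 / exp 1 \<and>
              (\<forall>W. admissible W \<longrightarrow> purity W \<le> \<mu>\<^sub>s \<longrightarrow>
                   wigner_entropy W \<ge> ereal (1 + ln pi)))"
proof (intro conjI allI impI notI)
  fix \<mu> :: real
  assume "0 < \<mu> \<and> \<mu> \<le> 2"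
  then show "\<exists>W. admissible W \<and> purity W = \<mu> \<and> wigner_entropy W = ereal (ln (2 * pi / \<mu>))"
    using exists_admissible_with_purity by blast
next
  fix \<mu> :: real
  assume "0 < \<mu> \<and> \<mu> \<le> 2 \<and> \<mu> > 2 / exp 1"
  then show "\<exists>W. admissible W \<and> purity W = \<mu> \<and>
      wigner_entropy W = ereal (ln (2 * pi / \<mu>)) \<and> ln (2 * pi / \<mu>) < 1 + ln pi"
    using exists_admissible_with_purity ln_two_pi_div_less by blast
next
  assume "\<exists>\<mu>\<^sub>s::real. \<mu>\<^sub>s > 2 / exp 1 \<and>
    (\<forall>W. admissible W \<longrightarrow> purity W \<le> \<mu>\<^sub>s \<longrightarrow> wigner_entropy W \<ge> ereal (1 + ln pi))"
  then obtain \<mu>\<^sub>s :: real where \<mu>\<^sub>s: "2 / exp 1 < \<mu>\<^sub>s"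
    and bound: "\<And>W. admissible W \<Longrightarrow> purity W \<le> \<mu>\<^sub>s \<Longrightarrow> wigner_entropy W \<ge> ereal (1 + ln pi)"
    by blast
  \<comment> \<open>Uniform densities reach purities only up to 2, hence the cap. It stays above
    \<open>2 / exp 1\<close> because e > 1, and it is at most \<open>\<mu>\<^sub>s\<close>, so the
    assumed implication applies to the witness.\<close>
  define \<mu> where "\<mu> = min \<mu>\<^sub>s 2"
  have "2 / exp 1 < (2 :: real)"
    by (simp add: field_simps)
  then have less: "2 / exp 1 < \<mu>"
    using \<mu>\<^sub>s by (simp add: \<mu>_def)
  moreover have "0 < 2 / exp (1 :: real)"
    by simp
  ultimately have "0 < \<mu>"
    by linarith
  then obtain W where "admissible W" "purity W = \<mu>"
    and W: "wigner_entropy W = ereal (ln (2 * pi / \<mu>))"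
    using exists_admissible_with_purity[of \<mu>] by (auto simp: \<mu>_def)
  then have "wigner_entropy W \<ge> ereal (1 + ln pi)"
    by (intro bound) (simp_all add: \<mu>_def)
  then show False
    using W ln_two_pi_div_less[OF less] by simp
qed

end
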